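(* Consider the equation $u_t+uu_{xxx}=0$ for $u=u(x,t)>0$. Each of the following two pairs is a conserved vector for this equation: (i) $A^0=\ln u$, $A^1=u_{xx}$; (ii) $C^0=3x^2\ln u$, $C^1=6u-6xu_x+3x^2u_{xx}$. That is, $D_tA^0+D_xA^1=0$ and $D_tC^0+D_xC^1=0$ hold on every smooth positive solution of $u_t+uu_{xxx}=0$.
   Context: $D_t$ and $D_x$ denote the total derivatives with respect to $t$ and $x$. A conserved vector for an evolution equation is a pair $(C^0,C^1)$ of functions of $x,t,u$ and finitely many derivatives of $u$ such that $D_tC^0+D_xC^1=0$ on all solutions of the equation. *)

theory Defs
  imports "HOL-Analysis.Analysis" "HOL-Library.Groups_Big_Fun"
begin

subsection \<open>Smooth functions of two variables\<close>

text \<open>A function of \<open>(x, t)\<close> is a function on \<^typ>\<open>real \<times> real\<close>, with \<open>x\<close> the first component.\<close>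

definition partial_x :: "(real \<times> real \<Rightarrow> real) \<Rightarrow> real \<times> real \<Rightarrow> real" where
  "partial_x u p = deriv (\<lambda>s. u (s, snd p)) (fst p)"

definition partial_t :: "(real \<times> real \<Rightarrow> real) \<Rightarrow> real \<times> real \<Rightarrow> real" where
  "partial_t u p = deriv (\<lambda>s. u (fst p, s)) (snd p)"

text \<open>On an open set, \<open>C\<^sup>k\<close> amounts to existence and continuity of all iterated partial
  derivatives up to order \<open>k\<close>.\<close>

fun C_k_on :: "nat \<Rightarrow> (real \<times> real) set \<Rightarrow> (real \<times> real \<Rightarrow> real) \<Rightarrow> bool" where
  "C_k_on 0 D u \<longleftrightarrow> continuous_on D u"
| "C_k_on (Suc k) D u \<longleftrightarrow> continuous_on D u \<and>
     (\<forall>p\<in>D. (\<lambda>s. u (s, snd p)) differentiable (at (fst p)) \<and>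
            (\<lambda>s. u (fst p, s)) differentiable (at (snd p))) \<and>
     C_k_on k D (partial_x u) \<and> C_k_on k D (partial_t u)"

definition smooth_on :: "(real \<times> real) set \<Rightarrow> (real \<times> real \<Rightarrow> real) \<Rightarrow> bool" where
  "smooth_on D u \<longleftrightarrow> (\<forall>k. C_k_on k D u)"

subsection \<open>Differential functions and total derivatives\<close>

text \<open>Coordinates of the infinite jet space: \<open>Jet i j\<close> is the coordinate belonging to the
  derivative of \<open>u\<close> taken \<open>i\<close> times in \<open>x\<close> and \<open>j\<close> times in \<open>t\<close>, so \<open>Jet 0 0\<close> is \<open>u\<close> itself.\<close>

datatype coord = Var_x | Var_t | Jet nat nat

type_synonym jet = "coord \<Rightarrow> real"

definition jet_of :: "(real \<times> real \<Rightarrow> real) \<Rightarrow> real \<times> real \<Rightarrow> jet" where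
  "jet_of u p c = (case c of
      Var_x \<Rightarrow> fst p
    | Var_t \<Rightarrow> snd p
    | Jet i j \<Rightarrow> (partial_t ^^ j) ((partial_x ^^ i) u) p)"

text \<open>Jets whose \<open>u\<close>-value lies in a prescribed set.\<close>

definition jet_domain :: "real set \<Rightarrow> jet set" where
  "jet_domain I = {z. z (Jet 0 0) \<in> I}"

definition jet_partial :: "coord \<Rightarrow> (jet \<Rightarrow> real) \<Rightarrow> jet \<Rightarrow> real" where
  "jet_partial c F z = deriv (\<lambda>s. F (z(c := s))) (z c)"

text \<open>Continuity on jet space refers to the product topology. For functions of finitely many
  coordinates it is ordinary continuity in these coordinates.\<close>

fun jet_C_k_on :: "nat \<Rightarrow> jet set \<Rightarrow> (jet \<Rightarrow> real) \<Rightarrow> bool" where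
  "jet_C_k_on 0 \<Omega> F \<longleftrightarrow> continuous_on \<Omega> F"
| "jet_C_k_on (Suc k) \<Omega> F \<longleftrightarrow> continuous_on \<Omega> F \<and>
     (\<forall>c. (\<forall>z\<in>\<Omega>. (\<lambda>s. F (z(c := s))) differentiable (at (z c))) \<and>
          jet_C_k_on k \<Omega> (jet_partial c F))"

definition differential_function :: "jet set \<Rightarrow> (jet \<Rightarrow> real) \<Rightarrow> bool" where
  "differential_function \<Omega> F \<longleftrightarrow>
     (\<exists>S. finite S \<and> (\<forall>z\<in>\<Omega>. \<forall>w\<in>\<Omega>. (\<forall>c\<in>S. z c = w c) \<longrightarrow> F z = F w)) \<and>
     (\<forall>k. jet_C_k_on k \<Omega> F)"

text \<open>The total derivatives
  \<open>D\<^sub>x = \<partial>\<^sub>x + u\<^sub>x \<partial>\<^sub>u + u\<^sub>x\<^sub>x \<partial>\<^bsub>u\<^sub>x\<^esub> + u\<^sub>t\<^sub>x \<partial>\<^bsub>u\<^sub>t\<^esub> + \<dots>\<close> and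
  \<open>D\<^sub>t = \<partial>\<^sub>t + u\<^sub>t \<partial>\<^sub>u + u\<^sub>x\<^sub>t \<partial>\<^bsub>u\<^sub>x\<^esub> + u\<^sub>t\<^sub>t \<partial>\<^bsub>u\<^sub>t\<^esub> + \<dots>\<close>.
  On a differential function only finitely many terms are nonzero.\<close>

definition total_x :: "(jet \<Rightarrow> real) \<Rightarrow> jet \<Rightarrow> real" where
  "total_x F z = jet_partial Var_x F z
     + Sum_any (\<lambda>(i, j). z (Jet (Suc i) j) * jet_partial (Jet i j) F z)"

definition total_t :: "(jet \<Rightarrow> real) \<Rightarrow> jet \<Rightarrow> real" where
  "total_t F z = jet_partial Var_t F z
     + Sum_any (\<lambda>(i, j). z (Jet i (Suc j)) * jet_partial (Jet i j) F z)"

subsection \<open>Solutions and conserved vectors\<close>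

text \<open>Smooth solutions of the equation \<open>E = 0\<close> on an open set \<open>D\<close>, with values in \<open>I\<close>.\<close>

definition is_solution ::
  "real set \<Rightarrow> (jet \<Rightarrow> real) \<Rightarrow> (real \<times> real) set \<Rightarrow> (real \<times> real \<Rightarrow> real) \<Rightarrow> bool" where
  "is_solution I E D u \<longleftrightarrow>
     open D \<and> smooth_on D u \<and> (\<forall>p\<in>D. u p \<in> I \<and> E (jet_of u p) = 0)"

definition conserved_vector ::
  "real set \<Rightarrow> (jet \<Rightarrow> real) \<Rightarrow> (jet \<Rightarrow> real) \<Rightarrow> (jet \<Rightarrow> real) \<Rightarrow> bool" where
  "conserved_vector I E C0 C1 \<longleftrightarrow>
     differential_function (jet_domain I) C0 \<and>
     differential_function (jet_domain I) C1 \<and>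
     (\<forall>D u. is_solution I E D u \<longrightarrow>
        (\<forall>p\<in>D. total_t C0 (jet_of u p) + total_x C1 (jet_of u p) = 0))"

text \<open>The equation \<open>u\<^sub>t + u u\<^sub>x\<^sub>x\<^sub>x = 0\<close>.\<close>

definition eqn :: "jet \<Rightarrow> real" where
  "eqn z = z (Jet 0 1) + z (Jet 0 0) * z (Jet 3 0)"

end

theory Submission
  imports Defs
begin

text \<open>A conserved density is differentiated symbolically on the jet space. In case (i) the total
  derivatives add up to \<open>u\<^sub>t / u + u\<^sub>x\<^sub>x\<^sub>x\<close>; in case (ii) all terms of lower order cancel and
  \<open>3 x\<^sup>2 (u\<^sub>t / u + u\<^sub>x\<^sub>x\<^sub>x)\<close> remains. Both are multiples of the equation with the factor \<open>1 / u\<close>.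
  No commutation of partial derivatives of \<open>u\<close> is involved.\<close>

subsection \<open>Closure properties of smooth functions on jet space\<close>

lemma open_jet_domain:
  assumes "open I"
  shows "open (jet_domain I)"
proof -
  have "open ((\<lambda>z::jet. z (Jet 0 0)) -` I)"
    by (intro open_vimage assms continuous_on_product_coordinates)
  then show ?thesis by (simp add: jet_domain_def vimage_def)
qed

text \<open>Changing a single coordinate is a continuous map into the product topology. Hence a
  partial derivative at a point of an open set only sees the values of the function on that
  set.\<close>

lemma eventually_fun_upd_in_open:
  fixes z :: jet
  assumes "open \<Omega>" "z \<in> \<Omega>"
  shows "\<forall>\<^sub>F s in nhds (z c). z(c := s) \<in> \<Omega>"
proof -
  have "continuous_on UNIV (\<lambda>s. z(c := s))"
  proof (rule continuous_on_coordinatewise_then_product)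
    fix i show "continuous_on UNIV (\<lambda>s. (z(c := s)) i)" by (cases "i = c") auto
  qed
  then have "open ((\<lambda>s. z(c := s)) -` \<Omega>)" by (intro open_vimage assms)
  moreover have "z c \<in> (\<lambda>s. z(c := s)) -` \<Omega>" using assms by simp
  ultimately show ?thesis unfolding eventually_nhds by blast
qed

lemma jet_partial_eqI:
  "((\<lambda>s. F (z(c := s))) has_real_derivative d) (at (z c)) \<Longrightarrow> jet_partial c F z = d"
  unfolding jet_partial_def by (rule DERIV_imp_deriv)

lemma has_real_derivative_jet_partial:
  assumes "(\<lambda>s. F (z(c := s))) differentiable (at (z c))"
  shows "((\<lambda>s. F (z(c := s))) has_real_derivative jet_partial c F z) (at (z c))"
  unfolding jet_partial_def using assms
  by (rule iffD2[OF DERIV_deriv_iff_real_differentiable])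

text \<open>Openness of \<open>\<Omega>\<close> is essential: agreement on \<open>\<Omega>\<close>
  gives agreement near each point along every coordinate line, hence equal partial derivatives on
  \<open>\<Omega>\<close>, and induction passes to higher orders.\<close>

lemma jet_C_k_on_cong:
  assumes "open \<Omega>" "jet_C_k_on k \<Omega> F" "\<And>z. z \<in> \<Omega> \<Longrightarrow> F z = G z"
  shows "jet_C_k_on k \<Omega> G"
  using assms(2,3)
proof (induction k arbitrary: F G)
  case 0
  then show ?case using continuous_on_cong[of \<Omega> \<Omega> F G] by simp
next
  case (Suc k)
  have ev: "\<forall>\<^sub>F s in nhds (z c). F (z(c := s)) = G (z(c := s))" if "z \<in> \<Omega>" for z c
    using eventually_fun_upd_in_open[OF \<open>open \<Omega>\<close> that, of c] by eventually_elim (rule Suc.prems(2))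
  have D: "((\<lambda>s. G (z(c := s))) has_real_derivative jet_partial c F z) (at (z c))"
    if "z \<in> \<Omega>" for z c
    using has_real_derivative_jet_partial[of F z c] Suc.prems(1) that
      DERIV_cong_ev[OF refl ev[OF that] refl] by simp
  have "jet_partial c F z = jet_partial c G z" if "z \<in> \<Omega>" for z c
    by (rule sym, rule jet_partial_eqI, rule D[OF that])
  then have "jet_C_k_on k \<Omega> (jet_partial c G)" for c
    using Suc.IH[of "jet_partial c F" "jet_partial c G"] Suc.prems(1) by simp
  moreover have "continuous_on \<Omega> G"
    using Suc.prems continuous_on_cong[of \<Omega> \<Omega> F G] by simp
  ultimately show ?case
    using D by (auto simp: real_differentiable_def)
qed

lemma jet_C_k_on_Suc_D: "jet_C_k_on (Suc k) \<Omega> F \<Longrightarrow> jet_C_k_on k \<Omega> F"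
  by (induction k arbitrary: F) auto

text \<open>Replaces the \<open>deriv\<close> hidden in \<open>jet_partial\<close> by an explicit
  formula \<open>G\<close>, which has to be correct only on \<open>\<Omega>\<close>. The closure
  properties below use it by exhibiting the formula from calculus.\<close>

lemma jet_C_k_on_SucI:
  assumes "open \<Omega>" "continuous_on \<Omega> F"
    and "\<And>z c. z \<in> \<Omega> \<Longrightarrow> ((\<lambda>s. F (z(c := s))) has_real_derivative G c z) (at (z c))"
    and "\<And>c. jet_C_k_on k \<Omega> (G c)"
  shows "jet_C_k_on (Suc k) \<Omega> F"
proof -
  have "G c z = jet_partial c F z" if "z \<in> \<Omega>" for z c
    by (rule sym, rule jet_partial_eqI, rule assms(3)[OF that])
  then have "jet_C_k_on k \<Omega> (jet_partial c F)" for c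
    by (rule jet_C_k_on_cong[OF assms(1) assms(4)])
  then show ?thesis
    using assms(2,3) by (auto simp: real_differentiable_def)
qed

lemma jet_C_k_on_SucD:
  assumes "jet_C_k_on (Suc k) \<Omega> F"
  shows "continuous_on \<Omega> F"
    and "z \<in> \<Omega> \<Longrightarrow> ((\<lambda>s. F (z(c := s))) has_real_derivative jet_partial c F z) (at (z c))"
    and "jet_C_k_on k \<Omega> (jet_partial c F)"
  using assms by (auto intro: has_real_derivative_jet_partial)

lemma jet_C_k_on_const: "open \<Omega> \<Longrightarrow> jet_C_k_on k \<Omega> (\<lambda>z. a)"
\<comment> \<open>The constant is generalised because the induction hypothesis is applied to the
  derivative 0.\<close>
proof (induction k arbitrary: a)
  case (Suc k)
  show ?case
    by (rule jet_C_k_on_SucI[where G = "\<lambda>c z. 0"]) (auto intro: Suc)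
qed simp

lemma jet_C_k_on_coord:
  assumes "open \<Omega>"
  shows "jet_C_k_on k \<Omega> (\<lambda>z. z c)"
proof (cases k)
  case 0
  then show ?thesis
    using continuous_on_subset[OF continuous_on_product_coordinates] by auto
next
  case (Suc m)
  show ?thesis unfolding Suc
  proof (rule jet_C_k_on_SucI[where G = "\<lambda>d z. if d = c then 1 else 0"])
    show "continuous_on \<Omega> (\<lambda>z. z c)"
      using continuous_on_subset[OF continuous_on_product_coordinates] by auto
    show "((\<lambda>s. (z(d := s)) c) has_real_derivative (if d = c then 1 else 0)) (at (z d))" for z d
      by (cases "d = c") auto
  qed (use assms in \<open>simp_all add: jet_C_k_on_const\<close>)
qed

lemma jet_C_k_on_add:
  assumes "open \<Omega>" "jet_C_k_on k \<Omega> F" "jet_C_k_on k \<Omega> G"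
  shows "jet_C_k_on k \<Omega> (\<lambda>z. F z + G z)"
  using assms(2,3)
proof (induction k arbitrary: F G)
  case 0
  then show ?case by (simp add: continuous_on_add)
next
  case (Suc k)
  note F = jet_C_k_on_SucD[OF Suc.prems(1)] and G = jet_C_k_on_SucD[OF Suc.prems(2)]
  show ?case
    by (rule jet_C_k_on_SucI[where G = "\<lambda>c z. jet_partial c F z + jet_partial c G z"])
      (intro assms continuous_on_add DERIV_add Suc.IH F G; assumption)+
qed

text \<open>The product rule also contains the undifferentiated factors; these are lowered from
  order \<open>Suc k\<close> to order \<open>k\<close> by \<open>jet_C_k_on_Suc_D\<close>.\<close>

lemma jet_C_k_on_mult:
  assumes "open \<Omega>" "jet_C_k_on k \<Omega> F" "jet_C_k_on k \<Omega> G"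
  shows "jet_C_k_on k \<Omega> (\<lambda>z. F z * G z)"
  using assms(2,3)
proof (induction k arbitrary: F G)
  case 0
  then show ?case by (simp add: continuous_on_mult)
next
  case (Suc k)
  note F = jet_C_k_on_SucD[OF Suc.prems(1)] and G = jet_C_k_on_SucD[OF Suc.prems(2)]
  show ?case
  proof (rule jet_C_k_on_SucI[where G = "\<lambda>c z. jet_partial c F z * G z + jet_partial c G z * F z"])
    show "((\<lambda>s. F (z(c := s)) * G (z(c := s))) has_real_derivative
        jet_partial c F z * G z + jet_partial c G z * F z) (at (z c))" if "z \<in> \<Omega>" for z c
      using DERIV_mult[OF F(2)[OF that] G(2)[OF that], of c] by (simp add: fun_upd_def)
  qed (intro assms continuous_on_mult jet_C_k_on_add Suc.IH F G
      jet_C_k_on_Suc_D[OF Suc.prems(1)] jet_C_k_on_Suc_D[OF Suc.prems(2)])+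
qed

lemma jet_C_k_on_diff:
  assumes "open \<Omega>" "jet_C_k_on k \<Omega> F" "jet_C_k_on k \<Omega> G"
  shows "jet_C_k_on k \<Omega> (\<lambda>z. F z - G z)"
  using jet_C_k_on_add[OF assms(1,2) jet_C_k_on_mult[OF assms(1) jet_C_k_on_const[of \<Omega> k "-1"] assms(3)]]
    assms(1) by simp

text \<open>The derivative \<open>- F' / F^2\<close> contains the reciprocal of the same
  \<open>F\<close>, so the induction keeps \<open>F\<close> fixed and uses the hypothesis for that
  reciprocal.\<close>

lemma jet_C_k_on_inverse:
  assumes "open \<Omega>" "jet_C_k_on k \<Omega> F" and nz: "\<And>z. z \<in> \<Omega> \<Longrightarrow> F z \<noteq> 0"
  shows "jet_C_k_on k \<Omega> (\<lambda>z. inverse (F z))"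
  using assms(2)
proof (induction k)
  case 0
  then show ?case using nz by (auto intro: continuous_on_inverse)
next
  case (Suc k)
  note F = jet_C_k_on_SucD[OF Suc.prems]
  have inv: "jet_C_k_on k \<Omega> (\<lambda>z. inverse (F z))"
    by (intro Suc.IH jet_C_k_on_Suc_D[OF Suc.prems])
  show ?case
  proof (rule jet_C_k_on_SucI[where
        G = "\<lambda>c z. -1 * (jet_partial c F z * (inverse (F z) * inverse (F z)))"])
    show "((\<lambda>s. inverse (F (z(c := s)))) has_real_derivative
        -1 * (jet_partial c F z * (inverse (F z) * inverse (F z)))) (at (z c))"
      if "z \<in> \<Omega>" for z c
      using DERIV_inverse_fun[OF F(2)[OF that], of c] nz[OF that]
      by (simp add: power2_eq_square algebra_simps fun_upd_def)
  qed (use nz in \<open>(intro assms continuous_on_inverse jet_C_k_on_mult jet_C_k_on_const inv F; simp)+\<close>)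
qed

text \<open>One differentiation gives \<open>F' / F\<close>, in which no logarithm is left; a case
  distinction on \<open>k\<close> therefore replaces induction.\<close>

lemma jet_C_k_on_ln:
  assumes "open \<Omega>" "jet_C_k_on k \<Omega> F" and pos: "\<And>z. z \<in> \<Omega> \<Longrightarrow> F z > 0"
  shows "jet_C_k_on k \<Omega> (\<lambda>z. ln (F z))"
proof (cases k)
  case 0
  then show ?thesis using assms(2) pos by (auto intro!: continuous_on_ln simp: less_imp_neq[symmetric])
next
  case (Suc m)
  note F = jet_C_k_on_SucD[OF assms(2)[unfolded Suc]]
  have nz: "F z \<noteq> 0" if "z \<in> \<Omega>" for z using pos[OF that] by simp
  have inv: "jet_C_k_on m \<Omega> (\<lambda>z. inverse (F z))"
    using jet_C_k_on_Suc_D assms(1,2) nz Suc by (intro jet_C_k_on_inverse) auto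
  show ?thesis unfolding Suc
  proof (rule jet_C_k_on_SucI[where G = "\<lambda>c z. jet_partial c F z * inverse (F z)"])
    show "((\<lambda>s. ln (F (z(c := s)))) has_real_derivative jet_partial c F z * inverse (F z)) (at (z c))"
      if "z \<in> \<Omega>" for z c
      \<comment> \<open>The chain rule evaluates the outer derivative at
        \<open>F (z(c := z c))\<close>, which simplifies to \<open>F z\<close>.\<close>
      using DERIV_chain2[OF DERIV_ln[of "F (z(c := z c))"] F(2)[OF that]] pos[OF that]
      by (simp add: mult.commute)
  qed (use nz in \<open>(intro assms continuous_on_ln jet_C_k_on_mult inv F; simp)+\<close>)
qed

lemma differential_functionI:
  assumes "finite S" "\<And>z w. (\<And>c. c \<in> S \<Longrightarrow> z c = w c) \<Longrightarrow> F z = F w"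
    and "\<And>k. jet_C_k_on k \<Omega> F"
  shows "differential_function \<Omega> F"
  unfolding differential_function_def using assms by blast

subsection \<open>Total derivatives\<close>

text \<open>\<open>Sum_any\<close> is 0 by default when the support is infinite, so a finite
  superset \<open>A\<close> of the support must be supplied before the sum can be evaluated.\<close>

lemma total_x_eq_sum:
  assumes "finite A" "\<And>i j. (i, j) \<notin> A \<Longrightarrow> jet_partial (Jet i j) F z = 0"
  shows "total_x F z = jet_partial Var_x F z
    + (\<Sum>(i, j)\<in>A. z (Jet (Suc i) j) * jet_partial (Jet i j) F z)"
proof -
  have "{(i, j). z (Jet (Suc i) j) * jet_partial (Jet i j) F z \<noteq> 0} \<subseteq> A"
    using assms(2) by auto
  then show ?thesis
    unfolding total_x_def using assms(1)
    by (subst Sum_any.expand_superset[of A]) (simp_all add: case_prod_unfold)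
qed

lemma total_t_eq_sum:
  assumes "finite A" "\<And>i j. (i, j) \<notin> A \<Longrightarrow> jet_partial (Jet i j) F z = 0"
  shows "total_t F z = jet_partial Var_t F z
    + (\<Sum>(i, j)\<in>A. z (Jet i (Suc j)) * jet_partial (Jet i j) F z)"
proof -
  have "{(i, j). z (Jet i (Suc j)) * jet_partial (Jet i j) F z \<noteq> 0} \<subseteq> A"
    using assms(2) by auto
  then show ?thesis
    unfolding total_t_def using assms(1)
    by (subst Sum_any.expand_superset[of A]) (simp_all add: case_prod_unfold)
qed

text \<open>Covers both densities: \<open>a = 1\<close>, \<open>n = 0\<close> for the first and
  \<open>a = 3\<close>, \<open>n = 2\<close> for the second. The factor in \<open>x\<close> is
  constant for the total derivative in \<open>t\<close>.\<close>

lemma total_t_mult_ln: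
  assumes "z (Jet 0 0) > 0"
  shows "total_t (\<lambda>z. a * (z Var_x) ^ n * ln (z (Jet 0 0))) z
    = a * (z Var_x) ^ n * (z (Jet 0 1) / z (Jet 0 0))"
proof -
  let ?F = "\<lambda>z::jet. a * (z Var_x) ^ n * ln (z (Jet 0 0))"
  have "jet_partial Var_t ?F z = 0"
    by (rule jet_partial_eqI) simp
  moreover have "jet_partial (Jet i j) ?F z
      = (if i = 0 \<and> j = 0 then a * (z Var_x) ^ n / z (Jet 0 0) else 0)" for i j
    by (rule jet_partial_eqI)
      (use assms in \<open>auto intro!: derivative_eq_intros\<close>)
  ultimately show ?thesis
    by (subst total_t_eq_sum[of "{(0, 0)}"]) auto
qed

lemma total_x_Jet: "total_x (\<lambda>z. z (Jet m n)) z = z (Jet (Suc m) n)"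
proof -
  let ?F = "\<lambda>z::jet. z (Jet m n)"
  have "jet_partial Var_x ?F z = 0"
    by (rule jet_partial_eqI) simp
  moreover have "jet_partial (Jet i j) ?F z = (if i = m \<and> j = n then 1 else 0)" for i j
    by (rule jet_partial_eqI) auto
  ultimately show ?thesis
    by (subst total_x_eq_sum[of "{(m, n)}"]) auto
qed

text \<open>The flux is the antiderivative of \<open>3 x^2 u_xxx\<close> obtained by repeated
  integration by parts. The explicit dependence on \<open>x\<close> contributes
  \<open>- 6 u_x + 6 x u_xx\<close>, which cancels the terms from \<open>u\<close> and
  \<open>u_x\<close>.\<close>

lemma total_x_quadratic_flux:
  "total_x (\<lambda>z. 6 * z (Jet 0 0) - 6 * z Var_x * z (Jet 1 0) + 3 * (z Var_x)\<^sup>2 * z (Jet 2 0)) z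
    = 3 * (z Var_x)\<^sup>2 * z (Jet 3 0)"
proof -
  let ?F = "\<lambda>z::jet. 6 * z (Jet 0 0) - 6 * z Var_x * z (Jet 1 0) + 3 * (z Var_x)\<^sup>2 * z (Jet 2 0)"
  have "jet_partial Var_x ?F z = - 6 * z (Jet 1 0) + 6 * z Var_x * z (Jet 2 0)"
    by (rule jet_partial_eqI) (auto intro!: derivative_eq_intros)
  moreover have "jet_partial (Jet i j) ?F z =
      (if j \<noteq> 0 then 0 else if i = 0 then 6 else if i = 1 then - 6 * z Var_x
       else if i = 2 then 3 * (z Var_x)\<^sup>2 else 0)" for i j
    by (rule jet_partial_eqI) (auto intro!: derivative_eq_intros)
  ultimately show ?thesis
    by (subst total_x_eq_sum[of "{(0, 0), (1, 0), (2, 0)}"])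
      (auto simp: eval_nat_numeral algebra_simps)
qed

theorem mainTheorem3:
  shows "conserved_vector {0<..} eqn
           (\<lambda>z. ln (z (Jet 0 0)))
           (\<lambda>z. z (Jet 2 0))
       \<and> conserved_vector {0<..} eqn
           (\<lambda>z. 3 * (z Var_x)\<^sup>2 * ln (z (Jet 0 0)))
           (\<lambda>z. 6 * z (Jet 0 0) - 6 * z Var_x * z (Jet 1 0) + 3 * (z Var_x)\<^sup>2 * z (Jet 2 0))"
proof -
  let ?\<Omega> = "jet_domain {0<..}"
  have op: "open ?\<Omega>" by (simp add: open_jet_domain)
  have ln: "jet_C_k_on k ?\<Omega> (\<lambda>z. ln (z (Jet 0 0)))" for k
    by (intro jet_C_k_on_ln jet_C_k_on_coord op) (simp add: jet_domain_def)
  have A0: "differential_function ?\<Omega> (\<lambda>z. ln (z (Jet 0 0)))"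
    by (rule differential_functionI[of "{Jet 0 0}"]) (simp_all add: ln)
  have A1: "differential_function ?\<Omega> (\<lambda>z. z (Jet 2 0))"
    by (rule differential_functionI[of "{Jet 2 0}"]) (simp_all add: jet_C_k_on_coord op)
  have C0: "differential_function ?\<Omega> (\<lambda>z. 3 * (z Var_x)\<^sup>2 * ln (z (Jet 0 0)))"
    \<comment> \<open>Squares become products, to which \<open>jet_C_k_on_mult\<close>
      applies.\<close>
    unfolding power2_eq_square
    by (rule differential_functionI[of "{Var_x, Jet 0 0}"])
      (simp, simp, intro jet_C_k_on_mult jet_C_k_on_const jet_C_k_on_coord op ln)
  have C1: "differential_function ?\<Omega>
      (\<lambda>z. 6 * z (Jet 0 0) - 6 * z Var_x * z (Jet 1 0) + 3 * (z Var_x)\<^sup>2 * z (Jet 2 0))"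
    unfolding power2_eq_square
    by (rule differential_functionI[of "{Var_x, Jet 0 0, Jet 1 0, Jet 2 0}"])
      (simp, simp, intro jet_C_k_on_add jet_C_k_on_diff jet_C_k_on_mult jet_C_k_on_const
        jet_C_k_on_coord op)
  \<comment> \<open>The equation divided by \<open>u > 0\<close>, in the form in which the total
    derivative of the logarithm produces \<open>u_t / u\<close>.\<close>
  have flux: "z (Jet 0 0) > 0 \<and> z (Jet 0 1) / z (Jet 0 0) = - z (Jet 3 0)"
    if "is_solution {0<..} eqn D u" "p \<in> D" "z = jet_of u p" for D u p z
  proof -
    have "z (Jet 0 0) > 0" "eqn z = 0"
      using that by (auto simp: is_solution_def jet_of_def)
    then show ?thesis by (auto simp: eqn_def field_simps)
  qed
  show ?thesis
    unfolding conserved_vector_def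
  proof (intro conjI A0 A1 C0 C1 allI impI ballI)
    fix D u p assume "is_solution {0<..} eqn D u" "p \<in> D"
    note * = flux[OF this refl]
    show "total_t (\<lambda>z. ln (z (Jet 0 0))) (jet_of u p) + total_x (\<lambda>z. z (Jet 2 0)) (jet_of u p) = 0"
      using * total_t_mult_ln[of "jet_of u p" 1 0] by (simp add: total_x_Jet eval_nat_numeral)
    show "total_t (\<lambda>z. 3 * (z Var_x)\<^sup>2 * ln (z (Jet 0 0))) (jet_of u p) +
        total_x (\<lambda>z. 6 * z (Jet 0 0) - 6 * z Var_x * z (Jet 1 0) + 3 * (z Var_x)\<^sup>2 * z (Jet 2 0))
          (jet_of u p) = 0"
      unfolding total_x_quadratic_flux
      \<comment> \<open>Without this deletion the quotient \<open>u_t / u\<close> would be merged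
        with its factor \<open>3 x^2\<close>, and the rewriting by \<open>flux\<close> would no
        longer match.\<close>
      using * by (simp add: total_t_mult_ln del: times_divide_eq_right)
  qed
qed

end
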